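(* For every $n \ge 6$ there exists $U \subseteq \mathbb{Z}_3^n$ with $|U| = 3^{n-1}+18$ such that the subgraph of $H(n,3)$ induced by $U$ has maximum degree $1$.
   Context: $H(n,3)$ is the Hamming graph: its vertex set is $\mathbb{Z}_3^n$ and two vertices are adjacent if and only if they differ in exactly one coordinate. *)

theory Defs
  imports "Graph_Theory.Digraph_Component" "HOL-Library.Numeral_Type"
begin

text \<open>
  Undirected simple graphs are symmetric loop-free digraphs without parallel arcs (locale
  \<^locale>\<open>graph\<close>): an edge between \<open>x\<close> and \<open>y\<close> is the pair of arcs \<open>(x, y)\<close> and \<open>(y, x)\<close>.
  The type \<^typ>\<open>3\<close> is the ring of integers modulo 3, and a vector over it with \<open>n\<close> coordinates
  is a list of length \<open>n\<close>.
\<close>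

definition hamming_graph :: "nat \<Rightarrow> (3 list, 3 list \<times> 3 list) pre_digraph" where
  "hamming_graph n = with_proj
     \<lparr> pverts = {x. length x = n},
       parcs = {(x, y). length x = n \<and> length y = n \<and> card {i. i < n \<and> x ! i \<noteq> y ! i} = 1} \<rparr>"

lemma graph_hamming_graph: "graph (hamming_graph n)"
proof -
  define d :: "3 list \<Rightarrow> 3 list \<Rightarrow> nat" where "d x y = card {i. i < n \<and> x ! i \<noteq> y ! i}" for x y
  have d_self: "d x x = 0" for x
    by (simp add: d_def)
  have d_sym: "d x y = d y x" for x y
    unfolding d_def by (rule arg_cong[where f = card]) auto
  let ?V = "{x :: 3 list. length x = n}"
  let ?G = "\<lparr> pverts = ?V, parcs = {(x, y). length x = n \<and> length y = n \<and> d x y = 1} \<rparr>"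
  have fin: "finite ?V"
    using finite_lists_length_eq[of "UNIV :: 3 set" n] by simp
  have "parcs ?G \<subseteq> ?V \<times> ?V"
    by auto
  then have fin': "finite (parcs ?G)"
    by (rule finite_subset) (intro finite_cartesian_product fin)
  have sym: "symmetric (with_proj ?G)"
    unfolding symmetric_def with_proj_simps by (rule symI) (simp add: d_sym)
  have "pair_graph ?G"
  proof
    show "e \<in> parcs ?G \<Longrightarrow> fst e \<in> pverts ?G" for e by (cases e) simp
    show "e \<in> parcs ?G \<Longrightarrow> snd e \<in> pverts ?G" for e by (cases e) simp
    show "finite (pverts ?G)" using fin by simp
    show "finite (parcs ?G)" by (rule fin')
    show "e \<in> parcs ?G \<Longrightarrow> fst e \<noteq> snd e" for e by (cases e) (auto simp: d_self)
    show "symmetric (with_proj ?G)" by (rule sym)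
  qed
  then show ?thesis
    unfolding hamming_graph_def d_def by (rule pair_graph.pair_graphD_graph)
qed

text \<open>
  In a symmetric digraph the out-degree of a vertex is the degree of that vertex in the
  undirected graph.  Meaningful only when the vertex set is finite and nonempty.
\<close>

definition max_degree :: "('a, 'b) pre_digraph \<Rightarrow> nat" where
  "max_degree G = Max (out_degree G ` verts G)"

end

theory Submission
  imports Defs
begin

text \<open>
  For \<open>n = 6\<close>, let \<open>C\<close> be the \<open>(6, 18, 4)\<close> ternary code and let \<open>U\<close> be the set of words at odd
  distance from \<open>C\<close>.  A word at distance 1 from \<open>c \<in> C\<close> can only be adjacent to the other word on
  the line through it and \<open>c\<close>, because words of \<open>C\<close> differ in at least 4 places, and the 45 words
  at distance 3 are isolated.  Every line in the direction of the last coordinate meets \<open>U\<close> in one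
  or two points, and exactly 18 of them in two.

  For larger \<open>n\<close>, replace the last coordinate \<open>w\<close> of \<open>Z\<^sub>3\<^sup>6\<close> by \<open>m\<close> coordinates \<open>y\<close>: over a line that
  meets \<open>U\<close> in \<open>{w}\<close> put the layer \<open>sum y = w\<close>, which is independent and has \<open>3\<^sup>m\<^sup>-\<^sup>1\<close> elements, and
  over a line that misses only \<open>c\<close> put a set of \<open>3\<^sup>m\<^sup>-\<^sup>1 + 1\<close> words inducing maximum degree 1 and
  disjoint from the layer \<open>sum y = c\<close>.
\<close>

section \<open>Hamming distance on lists\<close>

text \<open>The recursion serves both list induction and evaluation on concrete words. On lists of
  unequal length only the common range of positions counts.\<close>

fun hdist :: "'a list \<Rightarrow> 'a list \<Rightarrow> nat" where
  "hdist (a # x) (b # y) = (if a = b then 0 else 1) + hdist x y"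
| "hdist _ _ = 0"

lemma hdist_eq_card:
  assumes "length x = length y"
  shows "hdist x y = card {i. i < length x \<and> x ! i \<noteq> y ! i}"
proof -
  have "hdist x y = length (filter (\<lambda>(a, b). a \<noteq> b) (zip x y))"
    using assms by (induction x y rule: list_induct2) auto
  also have "\<dots> = card {i. i < length x \<and> x ! i \<noteq> y ! i}"
    unfolding length_filter_conv_card using assms by (intro arg_cong[where f = card]) auto
  finally show ?thesis .
qed

lemma hdist_append:
  assumes "length x = length x'"
  shows "hdist (x @ y) (x' @ y') = hdist x x' + hdist y y'"
  using assms by (induction x x' rule: list_induct2) auto

lemma hdist_commute: "hdist x y = hdist y x"
  by (induction x y rule: hdist.induct) auto

lemma hdist_self [simp]: "hdist x x = 0"
  by (induction x) auto

lemma hdist_eq_0_iff: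
  assumes "length x = length y"
  shows "hdist x y = 0 \<longleftrightarrow> x = y"
  using assms by (induction x y rule: list_induct2) auto

lemma hdist_triangle:
  assumes "length x = length y" "length y = length z"
  shows "hdist x z \<le> hdist x y + hdist y z"
  using assms by (induction x y z rule: list_induct3) auto

lemma hdist_map_inj_on:
  assumes "inj_on f A" "set x \<subseteq> A" "set y \<subseteq> A"
  shows "hdist (map f x) (map f y) = hdist x y"
  using assms(2,3)
  by (induction x y rule: hdist.induct) (auto dest: inj_onD[OF assms(1)])

section \<open>Induced matchings and maximum degree\<close>

definition induces_matching :: "'a list set \<Rightarrow> bool" where
  "induces_matching S \<longleftrightarrow>
     (\<forall>u\<in>S. \<forall>v\<in>S. \<forall>w\<in>S. hdist u v = 1 \<longrightarrow> hdist u w = 1 \<longrightarrow> v = w)"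

lemma induces_matchingD:
  assumes "induces_matching S" "u \<in> S" "v \<in> S" "w \<in> S" "hdist u v = 1" "hdist u w = 1"
  shows "v = w"
  using assms unfolding induces_matching_def by blast

text \<open>The matching property bounds every out-degree by 1; the edge \<open>a\<close>,
  \<open>b\<close> excludes maximum degree 0.\<close>

lemma max_degree_induced:
  assumes U: "U \<subseteq> {u. length u = n}" and match: "induces_matching U"
    and edge: "a \<in> U" "b \<in> U" "hdist a b = 1"
  shows "max_degree (hamming_graph n \<restriction> U) = 1"
proof -
  let ?G = "hamming_graph n \<restriction> U"
  have arcs: "out_arcs ?G u = {u} \<times> {v \<in> U. hdist u v = 1}" if "u \<in> U" for u
  proof -
    have "arcs (hamming_graph n) = {(x, y). length x = n \<and> length y = n \<and> hdist x y = 1}"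
      by (auto simp: hamming_graph_def hdist_eq_card)
    moreover have "tail (hamming_graph n) = fst" "head (hamming_graph n) = snd"
      by (simp_all add: hamming_graph_def)
    ultimately show ?thesis
      using that U by (auto simp: out_arcs_def)
  qed
  have fin: "finite U"
    using finite_subset[OF U] finite_lists_length_eq[of "UNIV :: 3 set" n] by simp
  have le: "out_degree ?G u \<le> 1" if "u \<in> U" for u
  proof -
    have "\<exists>w. {v \<in> U. hdist u v = 1} \<subseteq> {w}"
      using induces_matchingD[OF match that] by blast
    then obtain w where "{v \<in> U. hdist u v = 1} \<subseteq> {w}" ..
    then have "card {v \<in> U. hdist u v = 1} \<le> 1"
      using card_mono[of "{w}"] by simp
    then show ?thesis
      by (simp add: out_degree_def arcs that card_cartesian_product)
  qed
  have "card {v \<in> U. hdist a v = 1} > 0"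
    using edge fin by (auto simp: card_gt_0_iff)
  then have "out_degree ?G a = 1"
    using le[OF edge(1)] by (simp add: out_degree_def arcs edge(1) card_cartesian_product)
  moreover have "verts ?G = U"
    by simp
  ultimately show ?thesis
    unfolding max_degree_def using le fin edge(1)
    by (intro Max_eqI) (auto intro: rev_image_eqI)
qed

section \<open>Counting over the integers modulo 3\<close>

lemma third_element_unique:
  fixes a b c d :: 3
  assumes "a \<noteq> b" "a \<noteq> c" "b \<noteq> c" "a \<noteq> d" "b \<noteq> d"
  shows "c = d"
proof (rule ccontr)
  assume "c \<noteq> d"
  then have "card {a, b, c, d} = 4"
    using assms by simp
  moreover have "card {a, b, c, d} \<le> CARD(3)"
    by (intro card_mono) auto
  ultimately show False
    by simp
qed

lemma card_Compl_3: "card (- A :: 3 set) = 3 - card A"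
  by (simp add: Compl_eq_Diff_UNIV card_Diff_subset)

lemma card_3_list: "card {y :: 3 list. length y = n} = 3 ^ n"
  using card_lists_length_eq[of "UNIV :: 3 set" n] by simp

lemma finite_3_list [simp]: "finite {y :: 3 list. length y = n \<and> P y}"
  using finite_lists_length_eq[of "UNIV :: 3 set" n] by (auto intro: rev_finite_subset)

text \<open>The first entry is determined by the remaining ones, which are free.\<close>

lemma card_sum_layer: "card {y :: 3 list. length y = Suc n \<and> sum_list y = c} = 3 ^ n"
proof -
  have "{y :: 3 list. length y = Suc n \<and> sum_list y = c}
      = (\<lambda>y. (c - sum_list y) # y) ` {y. length y = n}"
    by (auto simp: length_Suc_conv image_iff)
  moreover have "inj_on (\<lambda>y :: 3 list. (c - sum_list y) # y) {y. length y = n}"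
    by (auto intro: inj_onI)
  ultimately show ?thesis
    by (simp add: card_image card_3_list)
qed

section \<open>Twisted layers\<close>

text \<open>
  Words with first entry 1 and 2 both sit over the layer \<open>sum = c\<close> of the remaining coordinates and
  so are matched to each other; those with first entry 0 avoid that layer.
\<close>

fun twisted_layer :: "3 \<Rightarrow> 3 list \<Rightarrow> bool" where
  "twisted_layer c [] = False"
| "twisted_layer c [z] = (z \<noteq> c)"
| "twisted_layer c (z # z' # y) =
     (if z = 0 then twisted_layer c (z' # y) else sum_list (z' # y) = c)"

lemma twisted_layer_Cons:
  "x \<noteq> [] \<Longrightarrow> twisted_layer c (z # x) = (if z = 0 then twisted_layer c x else sum_list x = c)"
  by (cases x) (simp, simp only: twisted_layer.simps)

text \<open>A leading 0 does not change the sum, and a leading \<open>z \<noteq> 0\<close> over a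
  tail of sum \<open>c\<close> gives \<open>z + c \<noteq> c\<close>.\<close>

lemma twisted_layer_avoids: "twisted_layer c y \<Longrightarrow> sum_list y \<noteq> c"
proof (induction y)
  case (Cons z x)
  show ?case
  proof (cases "x = []")
    case True
    then show ?thesis
      using Cons.prems by simp
  next
    case False
    then show ?thesis
      using Cons by (cases "z = 0") (auto simp: twisted_layer_Cons)
  qed
qed simp

text \<open>Splitting by first entry, 0 leads to the twisted layer one shorter and each of the two
  other values to a full sum layer. Hence the size starts at 2 and grows by twice a power of
  3.\<close>

lemma card_twisted_layer:
  "card {y. length y = Suc n \<and> twisted_layer c y} = 3 ^ n + 1"
proof (induction n)
  case 0
  have "{y. length y = Suc 0 \<and> twisted_layer c y} = (\<lambda>z. [z]) ` (- {c})" (is "?L = ?R")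
  proof (rule set_eqI)
    fix y
    show "y \<in> ?L \<longleftrightarrow> y \<in> ?R"
    proof (cases y)
      case (Cons z x)
      then show ?thesis
        by (cases x) (simp_all add: image_iff)
    qed auto
  qed
  then show ?case
    by (simp add: card_image inj_on_def card_Compl_3)
next
  case (Suc n)
  let ?S = "{y :: 3 list. length y = Suc n \<and> sum_list y = c}"
  let ?T = "{y. length y = Suc n \<and> twisted_layer c y}"
  have "{y. length y = Suc (Suc n) \<and> twisted_layer c y}
      = (#) 0 ` ?T \<union> (\<lambda>(z, y). z # y) ` ((- {0}) \<times> ?S)" (is "?L = ?R")
  proof (rule set_eqI)
    fix y :: "3 list"
    show "y \<in> ?L \<longleftrightarrow> y \<in> ?R"
    proof (cases y)
      case (Cons z x)
      show ?thesis
      proof (cases "length x = Suc n")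
        case True
        then have "x \<noteq> []"
          by auto
        then show ?thesis
          using True by (auto simp: Cons twisted_layer_Cons image_iff)
      qed (auto simp: Cons)
    qed auto
  qed
  moreover have "card ((#) 0 ` ?T) = 3 ^ n + 1"
    using Suc.IH by (simp add: card_image)
  moreover have "card ((\<lambda>(z, y). z # y) ` ((- {0}) \<times> ?S)) = card (- {0 :: 3}) * card ?S"
    by (subst card_image) (auto intro!: inj_onI simp: card_cartesian_product)
  moreover have "card (- {0 :: 3}) = 2"
    by (simp add: card_Compl_3)
  moreover have "(#) 0 ` ?T \<inter> (\<lambda>(z, y). z # y) ` ((- {0}) \<times> ?S) = {}"
    by auto
  ultimately show ?case
    by (simp add: card_Un_disjoint card_sum_layer)
qed

text \<open>Changing a single entry changes the sum, so constant-sum layers are independent.\<close>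

lemma hdist_1_sum_list:
  fixes y y' :: "3 list"
  assumes "length y = length y'" "hdist y y' = 1"
  shows "sum_list y \<noteq> sum_list y'"
  using assms
  by (induction y y' rule: list_induct2) (auto simp: hdist_eq_0_iff split: if_splits)

lemma hdist_Cons_1_iff:
  assumes "length x = length y"
  shows "hdist (a # x) (b # y) = 1 \<longleftrightarrow> a = b \<and> hdist x y = 1 \<or> a \<noteq> b \<and> x = y"
  using hdist_eq_0_iff[OF assms] by auto

text \<open>Words with first entry 0 are handled by induction. They have no neighbour with nonzero
  first entry, since their tails avoid sum \<open>c\<close>. Among words with nonzero first entry
  the tails form an independent layer, so an edge can only swap first entries 1 and 2.\<close>

lemma twisted_layer_matching:
  "induces_matching {y. length y = n \<and> twisted_layer c y}"
proof (induction n)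
  case 0
  show ?case
    by (simp add: induces_matching_def)
next
  case (Suc n)
  show ?case
  proof (cases n)
    case 0
    show ?thesis
      unfolding induces_matching_def
    proof (intro ballI impI)
      fix u v w
      assume uvw: "u \<in> {y. length y = Suc n \<and> twisted_layer c y}"
          "v \<in> {y. length y = Suc n \<and> twisted_layer c y}"
          "w \<in> {y. length y = Suc n \<and> twisted_layer c y}"
        and d: "hdist u v = 1" "hdist u w = 1"
      from uvw 0 obtain a b e where eq: "u = [a]" "v = [b]" "w = [e]"
        by (auto simp: length_Suc_conv)
      have "c \<noteq> a" "c \<noteq> b" "c \<noteq> e" "a \<noteq> b" "a \<noteq> e"
        using uvw d by (auto simp: eq)
      then have "b = e"
        by (intro third_element_unique[of c a])
      then show "v = w"
        by (simp add: eq)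
    qed
  next
    case (Suc k)
    have nbr: "if a = 0 then b = 0 \<and> twisted_layer c x \<and> twisted_layer c y \<and> hdist x y = 1
          else b \<noteq> 0 \<and> a \<noteq> b \<and> x = y"
      if "length x = n" "length y = n" "twisted_layer c (a # x)" "twisted_layer c (b # y)"
        "hdist (a # x) (b # y) = 1" for a b x y
    proof -
      have ne: "x \<noteq> []" "y \<noteq> []"
        using that(1,2) Suc by auto
      have a: "if a = 0 then twisted_layer c x else sum_list x = c"
        using that(3) unfolding twisted_layer_Cons[OF ne(1)] .
      have b: "if b = 0 then twisted_layer c y else sum_list y = c"
        using that(4) unfolding twisted_layer_Cons[OF ne(2)] .
      have "a = b \<and> hdist x y = 1 \<or> a \<noteq> b \<and> x = y"
        using that hdist_Cons_1_iff[of x y a b] by simp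
      then show ?thesis
      proof
        assume "a = b \<and> hdist x y = 1"
        then show ?thesis
          using a b hdist_1_sum_list[of x y] that(1,2) by metis
      next
        assume "a \<noteq> b \<and> x = y"
        then show ?thesis
          using a b twisted_layer_avoids[of c x] by metis
      qed
    qed
    show ?thesis
      unfolding induces_matching_def
    proof (intro ballI impI)
      fix u v w
      assume uvw: "u \<in> {y. length y = Suc n \<and> twisted_layer c y}"
          "v \<in> {y. length y = Suc n \<and> twisted_layer c y}"
          "w \<in> {y. length y = Suc n \<and> twisted_layer c y}"
        and d: "hdist u v = 1" "hdist u w = 1"
      from uvw obtain a x b y e z where eq: "u = a # x" "v = b # y" "w = e # z"
        and len: "length x = n" "length y = n" "length z = n"
        by (auto simp: length_Suc_conv)
      have xy: "if a = 0 then b = 0 \<and> twisted_layer c x \<and> twisted_layer c y \<and> hdist x y = 1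
          else b \<noteq> 0 \<and> a \<noteq> b \<and> x = y"
        using nbr[OF len(1,2)] uvw d unfolding eq by blast
      have xz: "if a = 0 then e = 0 \<and> twisted_layer c x \<and> twisted_layer c z \<and> hdist x z = 1
          else e \<noteq> 0 \<and> a \<noteq> e \<and> x = z"
        using nbr[OF len(1,3)] uvw d unfolding eq by blast
      show "v = w"
      proof (cases "a = 0")
        case True
        then show ?thesis
          using xy xz len induces_matchingD[OF Suc.IH, of x y z] unfolding eq mem_Collect_eq
          by metis
      next
        case False
        then have "b = e"
          using xy xz third_element_unique[of 0 a b e] by metis
        then show ?thesis
          using xy xz False unfolding eq by metis
      qed
    qed
  qed
qed

section \<open>Columns and the fibres replacing them\<close>

definition column :: "3 list set \<Rightarrow> 3 list \<Rightarrow> 3 set" where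
  "column S x = {w. x @ [w] \<in> S}"

text \<open>A single set expression covers both kinds of column: a one-point \<open>K\<close> yields
  a sum layer, a two-point \<open>K\<close> a twisted layer. For any other \<open>K\<close> the
  fibre is empty.\<close>

definition fibre :: "3 set \<Rightarrow> nat \<Rightarrow> 3 list set" where
  "fibre K m =
     {y. length y = m \<and> (K = {sum_list y} \<or> (\<exists>c. K = - {c} \<and> twisted_layer c y))}"

lemma length_fibre: "y \<in> fibre K m \<Longrightarrow> length y = m"
  unfolding fibre_def by blast

lemma finite_fibre: "finite (fibre K m)"
  unfolding fibre_def by (rule finite_3_list)

lemma singleton_neq_Compl: "{s} \<noteq> - {c :: 3}"
proof
  assume "{s} = - {c}"
  then have "card {s} = card (- {c})"
    by simp
  then show False
    by (simp add: card_Compl_3)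
qed

lemma fibre_singleton: "fibre {s} m = {y. length y = m \<and> sum_list y = s}"
  by (auto simp: fibre_def singleton_neq_Compl)

lemma fibre_Compl: "fibre (- {c}) m = {y. length y = m \<and> twisted_layer c y}"
  by (auto simp: fibre_def singleton_neq_Compl[symmetric])

lemma card_2_Compl:
  fixes K :: "3 set"
  assumes "card K = 2"
  obtains c where "K = - {c}"
proof -
  have "card (- K) = 1"
    using assms by (simp add: card_Compl_3)
  then obtain c where "- K = {c}"
    by (rule card_1_singletonE)
  then have "K = - {c}"
    by blast
  then show ?thesis
    by (rule that)
qed

lemma card_1_or_2_cases [consumes 1, case_names single double]:
  fixes K :: "3 set"
  assumes "card K \<in> {1, 2}"
  obtains (single) s where "K = {s}" | (double) c where "K = - {c}"
  using assms single double by (metis card_1_singletonE card_2_Compl insertE singletonD)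

lemma card_fibre:
  assumes "card K \<in> {1, 2}"
  shows "card (fibre K (Suc m)) = 3 ^ m + (if card K = 2 then 1 else 0)"
  using assms
  by (cases K rule: card_1_or_2_cases)
    (simp_all add: fibre_singleton fibre_Compl card_sum_layer card_twisted_layer card_Compl_3)

lemma fibre_matching:
  assumes "card K \<in> {1, 2}"
  shows "induces_matching (fibre K m)"
  using assms
proof (cases K rule: card_1_or_2_cases)
  case (single s)
  then show ?thesis
    unfolding induces_matching_def by (metis (mono_tags, lifting) fibre_singleton hdist_1_sum_list mem_Collect_eq)
next
  case (double c)
  then show ?thesis
    by (simp add: fibre_Compl twisted_layer_matching)
qed

section \<open>Replacing the last coordinate by several\<close>

definition extension :: "3 list set \<Rightarrow> nat \<Rightarrow> nat \<Rightarrow> 3 list set" where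
  "extension S k m = (\<lambda>(x, y). x @ y) ` (SIGMA x:{x. length x = k}. fibre (column S x) m)"

lemma extensionI:
  "length x = k \<Longrightarrow> y \<in> fibre (column S x) m \<Longrightarrow> x @ y \<in> extension S k m"
  unfolding extension_def by (rule image_eqI[of _ _ "(x, y)"]) auto

lemma extension_length: "extension S k m \<subseteq> {u. length u = k + m}"
  by (auto simp: extension_def dest: length_fibre)

lemma inj_on_append: "inj_on (\<lambda>(x, y). x @ y) (SIGMA x:{x. length x = k}. F x)"
  by (auto simp: inj_on_def)

text \<open>Every prefix contributes \<open>3 ^ m\<close> words and every two-point column one more,
  so the excess over the power of 3 does not depend on \<open>m\<close>.\<close>

lemma card_extension:
  assumes cols: "\<And>x. length x = k \<Longrightarrow> card (column S x) \<in> {1, 2}"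
  shows "card (extension S k (Suc m))
    = 3 ^ (k + m) + card {x. length x = k \<and> card (column S x) = 2}"
proof -
  let ?X = "{x :: 3 list. length x = k}"
  have "card (extension S k (Suc m)) = card (SIGMA x:?X. fibre (column S x) (Suc m))"
    unfolding extension_def by (intro card_image inj_on_append)
  also have "\<dots> = (\<Sum>x\<in>?X. card (fibre (column S x) (Suc m)))"
    using finite_3_list[of k "\<lambda>_. True"] by (subst card_SigmaI) (simp_all add: finite_fibre)
  also have "\<dots> = (\<Sum>x\<in>?X. 3 ^ m + (if card (column S x) = 2 then 1 else 0))"
    using cols by (intro sum.cong) (auto simp: card_fibre)
  also have "\<dots> = 3 ^ (k + m) + card {x \<in> ?X. card (column S x) = 2}"
    using finite_3_list[of k "\<lambda>_. True"]
    by (simp add: sum.distrib card_3_list power_add flip: sum.inter_filter)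
  finally show ?thesis
    by simp
qed

text \<open>An edge either stays inside the fibre over one prefix, or keeps \<open>y\<close> and
  joins adjacent prefixes. In the second case both columns are \<open>{sum_list y}\<close>, and the
  edge is a copy of an edge of \<open>S\<close>. The two kinds cannot meet at a vertex, so the
  matching property comes from the fibre or from \<open>S\<close>.\<close>

lemma extension_matching:
  assumes S: "induces_matching S"
    and cols: "\<And>x. length x = k \<Longrightarrow> card (column S x) \<in> {1, 2}"
  shows "induces_matching (extension S k m)"
proof -
  have nbr: "x = x' \<and> hdist y y' = 1 \<or>
      y = y' \<and> hdist x x' = 1 \<and> column S x = {sum_list y} \<and> column S x' = {sum_list y}"
    if len: "length x = k" "length x' = k"
      and y: "y \<in> fibre (column S x) m" "y' \<in> fibre (column S x') m"
      and d: "hdist (x @ y) (x' @ y') = 1" for x x' y y'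
  proof -
    have len': "length y = length y'"
      using y by (simp add: length_fibre)
    \<comment> \<open>A second point \<open>t\<close> in the column of \<open>v\<close> would make
      both \<open>v' @ [s]\<close> and \<open>v @ [t]\<close> neighbours of \<open>v @ [s]\<close>
      in \<open>S\<close>.\<close>
    have sub: "column S v \<subseteq> {s}"
      if "length v = k" "length v' = k" "hdist v v' = 1" "s \<in> column S v" "s \<in> column S v'"
      for v v' s
    proof
      fix t assume t: "t \<in> column S v"
      show "t \<in> {s}"
      proof (rule ccontr)
        assume "t \<notin> {s}"
        then have "v' @ [s] = v @ [t]"
          using that t
          by (intro induces_matchingD[OF S, of "v @ [s]"]) (auto simp: column_def hdist_append)
        then show False
          using \<open>t \<notin> {s}\<close> by simp
      qed
    qed
    consider "x = x'" "hdist y y' = 1" | "y = y'" "hdist x x' = 1"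
      using d len len' by (auto simp: hdist_append add_is_1 hdist_eq_0_iff)
    then show ?thesis
    proof cases
      case 2
      \<comment> \<open>The columns meet because \<open>y\<close> lies in both fibres: two sum
        layers containing \<open>y\<close> have the same \<open>s\<close>; a twisted layer for
        \<open>c\<close> containing \<open>y\<close> excludes \<open>sum_list y = c\<close>; and two
        2-subsets of a 3-element set always intersect.\<close>
      have "\<exists>s. s \<in> column S x \<and> s \<in> column S x'"
        using cols[OF len(1)]
      proof (cases rule: card_1_or_2_cases)
        case (single s)
        then have "sum_list y = s"
          using y by (simp add: fibre_singleton)
        show ?thesis
          using cols[OF len(2)]
        proof (cases rule: card_1_or_2_cases)
          case (double c)
          then show ?thesis
            using y single twisted_layer_avoids[of c y] \<open>sum_list y = s\<close> \<open>y = y'\<close>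
            by (simp add: fibre_Compl)
        qed (use y single 2 in \<open>simp add: fibre_singleton\<close>)
      next
        case (double c)
        show ?thesis
          using cols[OF len(2)]
        proof (cases rule: card_1_or_2_cases)
          case (single s)
          then show ?thesis
            using y double twisted_layer_avoids[of c y] \<open>y = y'\<close>
            by (simp add: fibre_Compl fibre_singleton)
        next
          case (double c')
          have "card {c, c'} < CARD(3)"
            using card_insert_le_m1[of 2 "{c'}" c] by (simp add: card_insert_if)
          then have "{c, c'} \<noteq> UNIV"
            by auto
          then show ?thesis
            using double \<open>column S x = - {c}\<close> by blast
        qed
      qed
      then obtain s where s: "s \<in> column S x" "s \<in> column S x'"
        by blast
      then have eq: "column S x = {s}" "column S x' = {s}"
        using sub[of x x' s] sub[of x' x s] len 2 hdist_commute[of x x'] by auto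
      then show ?thesis
        using y 2 by (auto simp: fibre_singleton)
    qed simp
  qed
  show ?thesis
    unfolding induces_matching_def
  proof (intro ballI impI)
    fix u v w
    assume "u \<in> extension S k m" "v \<in> extension S k m" "w \<in> extension S k m"
      and d: "hdist u v = 1" "hdist u w = 1"
    then obtain x x' x'' y y' y'' where
      eq: "u = x @ y" "v = x' @ y'" "w = x'' @ y''" and
      len: "length x = k" "length x' = k" "length x'' = k" and
      y: "y \<in> fibre (column S x) m" "y' \<in> fibre (column S x') m" "y'' \<in> fibre (column S x'') m"
      unfolding extension_def by fastforce
    have in_S: "v @ [sum_list y] \<in> S" if "column S v = {sum_list y}" for v
      using that unfolding column_def by blast
    \<comment> \<open>Over a one-point column the fibre is independent, so a vertex with an edge to
      another prefix has none inside its own fibre.\<close>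
    have no_mix: False
      if "column S x = {sum_list y}" "t \<in> fibre (column S x) m" "hdist y t = 1" for t
      using that y(1) hdist_1_sum_list[of y t] by (auto simp: fibre_singleton)
    from nbr[OF len(1,2) y(1,2)] nbr[OF len(1,3) y(1,3)] d
    consider "x = x'" "x = x''" "hdist y y' = 1" "hdist y y'' = 1"
      | "y = y'" "y = y''" "hdist x x' = 1" "hdist x x'' = 1"
        "column S x = {sum_list y}" "column S x' = {sum_list y}" "column S x'' = {sum_list y}"
      using no_mix[of y'] no_mix[of y''] y unfolding eq by blast
    then show "v = w"
    proof cases
      case 1
      then show ?thesis
        using induces_matchingD[OF fibre_matching[OF cols[OF len(1)]] y(1)] y by (simp add: eq)
    next
      case 2
      then have "x' @ [sum_list y] = x'' @ [sum_list y]"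
        using len
        by (intro induces_matchingD[OF S, of "x @ [sum_list y]"] in_S)
          (simp_all add: hdist_append)
      then show ?thesis
        using 2 by (simp add: eq)
    qed
  qed
qed

text \<open>Leading zeros reduce membership to the last entry, which may be either of the two values
  other than \<open>c\<close>; these two words are adjacent.\<close>

lemma twisted_layer_edge:
  "\<exists>y y'. y \<in> fibre (- {c}) (Suc m) \<and> y' \<in> fibre (- {c}) (Suc m) \<and> hdist y y' = 1"
proof -
  have *: "replicate m 0 @ [z] \<in> fibre (- {c}) (Suc m)" if "z \<noteq> c" for z
  proof -
    have "twisted_layer c (replicate m 0 @ [z])"
    proof (induction m)
      case (Suc m)
      then show ?case
        by (cases m) auto
    qed (use that in simp)
    then show ?thesis
      by (simp add: fibre_Compl)
  qed
  have "card (- {c}) = 2"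
    by (simp add: card_Compl_3)
  then obtain z z' where "- {c} = {z, z'}" "z \<noteq> z'"
    by (auto simp: card_2_iff)
  then have "z \<noteq> c" "z' \<noteq> c"
    by blast+
  then show ?thesis
    using * \<open>z \<noteq> z'\<close> by (intro exI[of _ "replicate m 0 @ [z]"] exI[of _ "replicate m 0 @ [z']"])
      (simp add: hdist_append)
qed

lemma extension_edge:
  assumes "length x = k" "card (column S x) = 2"
  shows "\<exists>a\<in>extension S k (Suc m). \<exists>b\<in>extension S k (Suc m). hdist a b = 1"
proof -
  obtain c where "column S x = - {c}"
    using card_2_Compl[OF assms(2)] .
  then obtain y y' where "y \<in> fibre (column S x) (Suc m)" "y' \<in> fibre (column S x) (Suc m)"
      "hdist y y' = 1"
    using twisted_layer_edge[of c m] by auto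
  then have "x @ y \<in> extension S k (Suc m)" "x @ y' \<in> extension S k (Suc m)"
      "hdist (x @ y) (x @ y') = 1"
    using extensionI[OF assms(1)] by (simp_all only: hdist_append hdist_self add_0_left)
  then show ?thesis
    by blast
qed

section \<open>Words at odd distance from a code\<close>

text \<open>Distance at least 3 in place of exactly 3: a lower bound can be checked codeword by
  codeword.\<close>

definition far :: "'a list list \<Rightarrow> 'a list \<Rightarrow> bool" where
  "far C u \<longleftrightarrow> list_all (\<lambda>c. 3 \<le> hdist u c) C"

definition odd_dist :: "'a list list \<Rightarrow> 'a list \<Rightarrow> bool" where
  "odd_dist C u \<longleftrightarrow> list_ex (\<lambda>c. hdist u c = 1) C \<or> far C u"

text \<open>Pairwise adjacent words all differ in the same coordinate, where \<open>c\<close> and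
  \<open>p\<close> leave a single value for any third word.\<close>

lemma line_third_unique:
  fixes c p q r :: "3 list"
  assumes "length c = length p" "length p = length q" "length q = length r"
    and "hdist c p = 1" "hdist c q = 1" "hdist p q = 1" "hdist c r = 1" "hdist p r = 1"
  shows "q = r"
  using assms
proof (induction c p q r rule: list_induct4)
  case (Cons c0 c p0 p q0 q r0 r)
  from Cons.prems have "c0 = p0 \<and> hdist c p = 1 \<or> c0 \<noteq> p0 \<and> c = p"
    "c0 = q0 \<and> hdist c q = 1 \<or> c0 \<noteq> q0 \<and> c = q"
    "p0 = q0 \<and> hdist p q = 1 \<or> p0 \<noteq> q0 \<and> p = q"
    "c0 = r0 \<and> hdist c r = 1 \<or> c0 \<noteq> r0 \<and> c = r"
    "p0 = r0 \<and> hdist p r = 1 \<or> p0 \<noteq> r0 \<and> p = r"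
    using Cons.hyps hdist_Cons_1_iff[of c p c0 p0] hdist_Cons_1_iff[of c q c0 q0]
      hdist_Cons_1_iff[of p q p0 q0] hdist_Cons_1_iff[of c r c0 r0] hdist_Cons_1_iff[of p r p0 r0]
    by simp_all
  then show ?case
    using Cons.IH third_element_unique[of c0 p0 q0 r0] by auto
qed simp

text \<open>Adjacent words of the set share a codeword at distance 1, so they are the other two
  points of a line through it. Minimum distance 4 makes this codeword the same for every neighbour
  of \<open>u\<close>, and the line has no further point.\<close>

lemma odd_dist_matching:
  fixes C :: "3 list list"
  assumes len: "\<And>c. c \<in> set C \<Longrightarrow> length c = n"
    and dist: "\<And>c c'. c \<in> set C \<Longrightarrow> c' \<in> set C \<Longrightarrow> c \<noteq> c' \<Longrightarrow> 4 \<le> hdist c c'"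
    and far: "\<And>u v. length u = n \<Longrightarrow> length v = n \<Longrightarrow> far C u \<Longrightarrow> far C v \<Longrightarrow> hdist u v \<noteq> 1"
  shows "induces_matching {u. length u = n \<and> odd_dist C u}"
proof -
  have nbr: "\<exists>c\<in>set C. hdist c u = 1 \<and> hdist c v = 1"
    if uv: "length u = n" "length v = n" "odd_dist C u" "odd_dist C v" "hdist u v = 1" for u v
  proof -
    \<comment> \<open>A neighbour of a word at distance 1 from \<open>c\<close> is within distance 2
      of \<open>c\<close>.\<close>
    have not_far: "\<not> far C v"
      if "c \<in> set C" "length u = n" "length v = n" "hdist c u = 1" "hdist u v = 1" for c u v
    proof -
      have "hdist v c \<le> 2"
        using that len[OF that(1)] hdist_triangle[of c u v] by (simp add: hdist_commute[of v c])
      then show ?thesis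
        using that(1) by (force simp: far_def list_all_iff)
    qed
    obtain c where c: "c \<in> set C" "hdist c u = 1"
    proof (cases "far C u")
      case True
      then have "\<not> far C v"
        using far uv by blast
      then obtain c where "c \<in> set C" "hdist c v = 1"
        using uv(4) by (auto simp: odd_dist_def list_ex_iff hdist_commute)
      then show ?thesis
        using not_far[of c v u] True uv hdist_commute[of u v] by simp
    next
      case False
      then show ?thesis
        using uv(3) that by (auto simp: odd_dist_def list_ex_iff hdist_commute)
    qed
    then have "\<not> far C v"
      using not_far uv by blast
    then obtain c' where c': "c' \<in> set C" "hdist v c' = 1"
      using uv(4) by (auto simp: odd_dist_def list_ex_iff)
    \<comment> \<open>The path \<open>c\<close>, \<open>u\<close>, \<open>v\<close>,
      \<open>c'\<close> has three steps, below the minimum distance 4.\<close>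
    have "hdist c c' \<le> 3"
      using hdist_triangle[of c u c'] hdist_triangle[of u v c'] c c' len uv by simp
    then have "c = c'"
      using dist[of c c'] c c' by force
    then show ?thesis
      using c c' hdist_commute[of v c'] by auto
  qed
  show ?thesis
    unfolding induces_matching_def
  proof (intro ballI impI)
    fix u v w
    assume uvw: "u \<in> {u. length u = n \<and> odd_dist C u}" "v \<in> {u. length u = n \<and> odd_dist C u}"
        "w \<in> {u. length u = n \<and> odd_dist C u}"
      and d: "hdist u v = 1" "hdist u w = 1"
    obtain c where c: "c \<in> set C" "hdist c u = 1" "hdist c v = 1"
      using nbr[of u v] uvw d by auto
    obtain c' where c': "c' \<in> set C" "hdist c' u = 1" "hdist c' w = 1"
      using nbr[of u w] uvw d by auto
    have "hdist c c' \<le> 2"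
      using hdist_triangle[of c u c'] hdist_commute[of u c'] c c' len uvw by simp
    then have "c = c'"
      using dist[of c c'] c c' by force
    then show "v = w"
      using line_third_unique[of c u v w] c c' len uvw d by simp
  qed
qed

section \<open>The ternary code of length 6 and its evaluation\<close>

text \<open>
  The translates by constant words of the rows of the Paley-type generalized Hadamard matrix of
  order 6 over \<open>Z\<^sub>3\<close>, where \<open>0, 1, 2, 2, 1\<close> are the quadratic characters modulo 5.  The digits are
  natural numbers because equality on the type \<open>3\<close> does not evaluate well by rewriting.
\<close>

definition gh_code :: "nat list list" where
  "gh_code = concat (map (\<lambda>c. map (map (\<lambda>a. (a + c) mod 3))
     ([0, 0, 0, 0, 0, 0] # map (\<lambda>j. rotate j [0, 1, 2, 2, 1] @ [0]) [0..<5])) [0, 1, 2])"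

definition digit_words :: "nat \<Rightarrow> nat list list" where
  "digit_words n = List.n_lists n [0, 1, 2]"

definition no_edge :: "'a list list \<Rightarrow> bool" where
  "no_edge L \<longleftrightarrow> list_all (\<lambda>p. list_all (\<lambda>q. hdist p q \<noteq> 1) L) L"

definition digit_column :: "nat list \<Rightarrow> nat list" where
  "digit_column x = filter (\<lambda>w. odd_dist gh_code (x @ [w])) [0, 1, 2]"

lemma gh_code_words: "list_all (\<lambda>c. length c = 6 \<and> list_all (\<lambda>a. a < 3) c) gh_code"
  by code_simp

lemma gh_code_dist: "list_all (\<lambda>c. list_all (\<lambda>c'. c = c' \<or> 4 \<le> hdist c c') gh_code) gh_code"
  by code_simp

text \<open>Supplies, after transfer to the type \<open>3\<close>, the independence of far words
  required by \<open>odd_dist_matching\<close>.\<close>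

lemma gh_code_far: "no_edge (filter (far gh_code) (digit_words 6))"
  by code_simp

lemma digit_column_length:
  "list_all (\<lambda>l. l = 1 \<or> l = 2) (map (length \<circ> digit_column) (digit_words 5))"
  by code_simp

text \<open>Evaluation over all 243 prefixes; this is the source of the summand 18 in the
  theorem.\<close>

lemma digit_column_double:
  "length (filter (\<lambda>l. l = 2) (map (length \<circ> digit_column) (digit_words 5))) = 18"
  by code_simp

section \<open>Transfer from digits to the integers modulo 3\<close>

abbreviation digit :: "nat \<Rightarrow> 3" where "digit \<equiv> of_nat"

lemma set_digit_words:
  "set (digit_words n) = {z. length z = n \<and> set z \<subseteq> {..<3}}"
proof -
  have "{0, 1, 2 :: nat} = {..<3}"
    by auto
  then show ?thesis
    by (simp add: digit_words_def set_n_lists)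
qed

lemma inj_digit: "inj_on digit {..<3}"
proof -
  have "{..<3} = {0, 1, 2 :: nat}"
    by auto
  then show ?thesis
    by (simp add: inj_on_def)
qed

lemma digit_image: "digit ` {..<3} = UNIV"
proof -
  have "card (digit ` {..<3}) = CARD(3)"
    by (simp add: card_image inj_digit)
  then show ?thesis
    by (intro card_subset_eq) auto
qed

lemma digit_lists:
  "{x :: 3 list. length x = n} = map digit ` set (digit_words n)"
proof (intro equalityI subsetI)
  fix x :: "3 list"
  assume x: "x \<in> {x. length x = n}"
  let ?z = "map (inv_into {..<3} digit) x"
  have "inv_into {..<3} digit a < 3" for a
    using inv_into_into[of a digit "{..<3}"] by (simp add: digit_image)
  then have "?z \<in> set (digit_words n)"
    unfolding set_digit_words using x by auto
  moreover have "x = map digit ?z"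
    by (simp add: digit_image f_inv_into_f map_idI)
  ultimately show "x \<in> map digit ` set (digit_words n)"
    by (rule rev_image_eqI)
qed (auto simp: set_digit_words)

abbreviation gh_code3 :: "3 list list" where "gh_code3 \<equiv> map (map digit) gh_code"

lemma gh_code_digits: "c \<in> set gh_code \<Longrightarrow> length c = 6 \<and> set c \<subseteq> {..<3}"
  using gh_code_words by (auto simp: list_all_iff)

lemma hdist_digits:
  "set x \<subseteq> {..<3} \<Longrightarrow> set y \<subseteq> {..<3} \<Longrightarrow> hdist (map digit x) (map digit y) = hdist x y"
  by (rule hdist_map_inj_on[OF inj_digit])

lemma far_digits: "set z \<subseteq> {..<3} \<Longrightarrow> far gh_code3 (map digit z) \<longleftrightarrow> far gh_code z"
  using gh_code_digits by (simp add: far_def list_all_iff hdist_digits)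

lemma odd_dist_digits: "set z \<subseteq> {..<3} \<Longrightarrow> odd_dist gh_code3 (map digit z) \<longleftrightarrow> odd_dist gh_code z"
  using gh_code_digits by (simp add: odd_dist_def list_ex_iff hdist_digits far_digits)

section \<open>The base set in dimension 6\<close>

definition base :: "3 list set" where
  "base = {u. length u = 6 \<and> odd_dist gh_code3 u}"

lemma base_matching: "induces_matching base"
  unfolding base_def
proof (rule odd_dist_matching)
  fix c assume "c \<in> set gh_code3"
  then show "length c = 6"
    using gh_code_digits by auto
next
  fix c c' assume "c \<in> set gh_code3" "c' \<in> set gh_code3" "c \<noteq> c'"
  then show "4 \<le> hdist c c'"
    using gh_code_dist gh_code_digits by (fastforce simp: list_all_iff hdist_digits)
next
  fix u v :: "3 list"
  assume "length u = 6" "length v = 6" and f: "far gh_code3 u" "far gh_code3 v"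
  then obtain x y where x: "x \<in> set (digit_words 6)" "u = map digit x"
    and y: "y \<in> set (digit_words 6)" "v = map digit y"
    using digit_lists[of 6] by blast
  have sub: "set x \<subseteq> {..<3}" "set y \<subseteq> {..<3}"
    using x(1) y(1) unfolding set_digit_words by auto
  then have "far gh_code x" "far gh_code y"
    using f by (simp_all add: x(2) y(2) far_digits)
  then have "hdist x y \<noteq> 1"
    using gh_code_far x(1) y(1) unfolding no_edge_def list_all_iff by auto
  then show "hdist u v \<noteq> 1"
    using sub by (simp add: x(2) y(2) hdist_digits)
qed

text \<open>\<open>digit\<close> is a bijection from \<open>{..<3}\<close> onto the type
  \<open>3\<close>, so the column is the injective image of the evaluated list, whose entries are
  distinct.\<close>

lemma card_column_base:
  assumes "z \<in> set (digit_words 5)"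
  shows "card (column base (map digit z)) = length (digit_column z)"
proof -
  have z: "length z = 5" "set z \<subseteq> {..<3}"
    using assms unfolding set_digit_words by auto
  have *: "digit a \<in> column base (map digit z) \<longleftrightarrow> odd_dist gh_code (z @ [a])" if "a < 3" for a
    using odd_dist_digits[of "z @ [a]"] z that by (simp add: column_def base_def)
  have "{..<3} = {0, 1, 2 :: nat}"
    by auto
  then have set_col: "set (digit_column z) = {a \<in> {..<3}. odd_dist gh_code (z @ [a])}"
    by (simp only: digit_column_def set_filter list.set)
  have "column base (map digit z) = digit ` {a \<in> {..<3}. digit a \<in> column base (map digit z)}"
  proof (intro equalityI subsetI)
    fix w
    assume w: "w \<in> column base (map digit z)"
    obtain a where "w = digit a" "a < 3"
      using digit_image by (metis UNIV_I imageE lessThan_iff)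
    then show "w \<in> digit ` {a \<in> {..<3}. digit a \<in> column base (map digit z)}"
      using w by (intro image_eqI[of _ _ a]) simp_all
  qed auto
  also have "{a \<in> {..<3}. digit a \<in> column base (map digit z)} = set (digit_column z)"
    unfolding set_col using * by blast
  also have "card (digit ` set (digit_column z)) = card (set (digit_column z))"
    unfolding set_col by (intro card_image inj_on_subset[OF inj_digit]) blast
  also have "\<dots> = length (digit_column z)"
    by (intro distinct_card) (simp add: digit_column_def)
  finally show ?thesis .
qed

lemma base_columns:
  assumes "length x = 5"
  shows "card (column base x) \<in> {1, 2}"
proof -
  from assms obtain z where "z \<in> set (digit_words 5)" "x = map digit z"
    using digit_lists[of 5] by blast
  then show ?thesis
    using digit_column_length by (auto simp: card_column_base list_all_iff)
qed

lemma base_double_columns: "card {x. length x = 5 \<and> card (column base x) = 2} = 18"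
proof -
  let ?Z = "filter (\<lambda>z. length (digit_column z) = 2) (digit_words 5)"
  have "{x. length x = 5 \<and> card (column base x) = 2}
      = {x \<in> map digit ` set (digit_words 5). card (column base x) = 2}"
    using digit_lists[of 5] by auto
  also have "\<dots> = map digit ` set ?Z"
    by (auto simp: card_column_base)
  also have "card \<dots> = card (set ?Z)"
  proof (rule card_image, rule inj_onI)
    fix x y
    assume "x \<in> set ?Z" "y \<in> set ?Z" and eq: "map digit x = map digit y"
    then have "set x \<union> set y \<subseteq> {..<3}"
      by (auto simp: set_digit_words)
    then show "x = y"
      using eq inj_on_subset[OF inj_digit] by (intro map_inj_on[of digit]) auto
  qed
  also have "\<dots> = length ?Z"
    by (intro distinct_card distinct_filter) (simp add: digit_words_def distinct_n_lists)
  also have "\<dots> = 18"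
    using digit_column_double by (simp add: filter_map comp_def)
  finally show ?thesis .
qed

section \<open>The construction in every dimension from 6 on\<close>

theorem theorem1p4:
  fixes n :: nat
  assumes "n \<ge> 6"
  shows "\<exists>U. U \<subseteq> verts (hamming_graph n) \<and> card U = 3 ^ (n - 1) + 18 \<and>
             max_degree (hamming_graph n \<restriction> U) = 1"
proof -
  define m where "m = n - 6"
  \<comment> \<open>Five coordinates of \<open>base\<close> are kept and the sixth becomes
    \<open>Suc m\<close> coordinates, at least one. The main term of the size is then
    \<open>3 ^ (5 + m)\<close>, which is \<open>3 ^ (n - 1)\<close>.\<close>
  have m: "n = 5 + Suc m"
    using assms by (simp add: m_def)
  let ?U = "extension base 5 (Suc m)"
  have len: "?U \<subseteq> {u. length u = n}"
    using extension_length[of base 5 "Suc m"] by (simp add: m)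
  then have "?U \<subseteq> verts (hamming_graph n)"
    by (simp add: hamming_graph_def with_proj_def)
  moreover have "card ?U = 3 ^ (n - 1) + 18"
    using card_extension[OF base_columns] by (simp add: base_double_columns m)
  moreover have "max_degree (hamming_graph n \<restriction> ?U) = 1"
  proof -
    have match: "induces_matching ?U"
      by (intro extension_matching base_matching base_columns)
    \<comment> \<open>Since 18 is positive there is a two-point column, and the twisted layer over
      it contains an edge.\<close>
    have "{x. length x = 5 \<and> card (column base x) = 2} \<noteq> {}"
      using base_double_columns by fastforce
    then obtain x where "length x = 5" "card (column base x) = 2"
      by blast
    then obtain a b where "a \<in> ?U" "b \<in> ?U" "hdist a b = 1"
      using extension_edge by blast
    then show ?thesis
      by (rule max_degree_induced[OF len match])
  qed
  ultimately show ?thesis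
    by blast
qed

end
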